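(* Let $S$ be a semiring. (1) Let $M$ be a left $S$-semimodule. Every retract of an $M$-$e$-injective left $S$-semimodule is $M$-$e$-injective. (2) Every retract of an $e$-injective left $S$-semimodule is $e$-injective.
   Context: A semiring $(S,+,0,\cdot,1)$ consists of a commutative monoid $(S,+,0)$ and a monoid $(S,\cdot,1)$ with $0\neq 1$, $a0=0=0a$, and both distributive laws. A left $S$-semimodule is a commutative monoid with a unital action of $S$ satisfying the usual module axioms, including $0m=0$ and $s0=0$ (no additive inverses required). For an $S$-linear map $f:L\to M$ let $\mathrm{Ker}(f)=\{l\in L\mid f(l)=0\}$. The map $f$ is $k$-normal if whenever $f(l)=f(l')$ with $l,l'\in L$, there are $k,k'\in \mathrm{Ker}(f)$ with $l+k=l'+k'$. A sequence $L\xrightarrow{f}M\xrightarrow{g}N$ is exact if $f(L)=\mathrm{Ker}(g)$ and $g$ is $k$-normal; a longer sequence is exact if each three-term part is exact. The same definitions apply to commutative monoids, viewed as semimodules over $\mathbb{Z}^{+}$ (the non-negative integers). A left $S$-semimodule $J$ is $M$-$e$-injective if for every short exact sequence $0\to L\xrightarrow{f}M\xrightarrow{g}N\to 0$ of left $S$-semimodules (with middle term $M$) the induced sequence of commutative monoids $0\to \mathrm{Hom}_S(N,J)\to \mathrm{Hom}_S(M,J)\to \mathrm{Hom}_S(L,J)\to 0$ is exact. $J$ is $e$-injective if it is $M$-$e$-injective for every left $S$-semimodule $M$. A left $S$-semimodule $I$ is a retract of $J$ if there are $S$-linear maps $\psi:I\to J$ and $\theta:J\to I$ with $\theta\circ\psi=\mathrm{id}_I$.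 *)

theory Defs
  imports "HOL-Algebra.Module" "HOL-Library.FuncSet"
begin

section \<open>Semimodules and linear maps\<close>

text \<open>The library locale \<^locale>\<open>semiring\<close> admits the one-element semiring; here it is excluded.\<close>

locale nonzero_semiring = semiring S for S (structure) +
  assumes zero_neq_one: "\<zero> \<noteq> \<one>"

text \<open>Semimodules are carried by the library's \<^type>\<open>module\<close> records, whose inherited ring
  multiplication and unit are unused, as they are for the locale \<^locale>\<open>module\<close>.\<close>

locale left_semimodule = S?: nonzero_semiring S + M?: abelian_monoid M
  for S (structure) and M :: "('s, 'm) module" (structure) +
  assumes smult_closed:
      "\<lbrakk> a \<in> carrier S; x \<in> carrier M \<rbrakk> \<Longrightarrow> a \<odot>\<^bsub>M\<^esub> x \<in> carrier M"
    and smult_l_distr: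
      "\<lbrakk> a \<in> carrier S; b \<in> carrier S; x \<in> carrier M \<rbrakk> \<Longrightarrow>
        (a \<oplus>\<^bsub>S\<^esub> b) \<odot>\<^bsub>M\<^esub> x = a \<odot>\<^bsub>M\<^esub> x \<oplus>\<^bsub>M\<^esub> b \<odot>\<^bsub>M\<^esub> x"
    and smult_r_distr:
      "\<lbrakk> a \<in> carrier S; x \<in> carrier M; y \<in> carrier M \<rbrakk> \<Longrightarrow>
        a \<odot>\<^bsub>M\<^esub> (x \<oplus>\<^bsub>M\<^esub> y) = a \<odot>\<^bsub>M\<^esub> x \<oplus>\<^bsub>M\<^esub> a \<odot>\<^bsub>M\<^esub> y"
    and smult_assoc:
      "\<lbrakk> a \<in> carrier S; b \<in> carrier S; x \<in> carrier M \<rbrakk> \<Longrightarrow>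
        (a \<otimes>\<^bsub>S\<^esub> b) \<odot>\<^bsub>M\<^esub> x = a \<odot>\<^bsub>M\<^esub> (b \<odot>\<^bsub>M\<^esub> x)"
    and smult_one: "x \<in> carrier M \<Longrightarrow> \<one>\<^bsub>S\<^esub> \<odot>\<^bsub>M\<^esub> x = x"
    and smult_l_null: "x \<in> carrier M \<Longrightarrow> \<zero>\<^bsub>S\<^esub> \<odot>\<^bsub>M\<^esub> x = \<zero>\<^bsub>M\<^esub>"
    and smult_r_null: "a \<in> carrier S \<Longrightarrow> a \<odot>\<^bsub>M\<^esub> \<zero>\<^bsub>M\<^esub> = \<zero>\<^bsub>M\<^esub>"

definition linear_map ::
  "('s, 'r) ring_scheme \<Rightarrow> ('s, 'l) module \<Rightarrow> ('s, 'm) module \<Rightarrow> ('l \<Rightarrow> 'm) \<Rightarrow> bool" where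
  "linear_map S L M f \<longleftrightarrow>
     f \<in> carrier L \<rightarrow> carrier M \<and>
     (\<forall>x\<in>carrier L. \<forall>y\<in>carrier L. f (x \<oplus>\<^bsub>L\<^esub> y) = f x \<oplus>\<^bsub>M\<^esub> f y) \<and>
     (\<forall>a\<in>carrier S. \<forall>x\<in>carrier L. f (a \<odot>\<^bsub>L\<^esub> x) = a \<odot>\<^bsub>M\<^esub> f x)"

section \<open>Exact sequences\<close>

text \<open>Kernels, k-normality and exactness involve only the additive structure, so they are stated
  for \<^type>\<open>ring_scheme\<close> records and apply both to semimodules and to commutative monoids.\<close>

definition Ker ::
  "('a, 'c) ring_scheme \<Rightarrow> ('b, 'd) ring_scheme \<Rightarrow> ('a \<Rightarrow> 'b) \<Rightarrow> 'a set" where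
  "Ker L M f = {l \<in> carrier L. f l = \<zero>\<^bsub>M\<^esub>}"

definition k_normal ::
  "('a, 'c) ring_scheme \<Rightarrow> ('b, 'd) ring_scheme \<Rightarrow> ('a \<Rightarrow> 'b) \<Rightarrow> bool" where
  "k_normal L M f \<longleftrightarrow>
     (\<forall>l\<in>carrier L. \<forall>l'\<in>carrier L. f l = f l' \<longrightarrow>
        (\<exists>k\<in>Ker L M f. \<exists>k'\<in>Ker L M f. l \<oplus>\<^bsub>L\<^esub> k = l' \<oplus>\<^bsub>L\<^esub> k'))"

definition exact ::
  "('a, 'd) ring_scheme \<Rightarrow> ('b, 'e) ring_scheme \<Rightarrow> ('c, 'f) ring_scheme \<Rightarrow>
   ('a \<Rightarrow> 'b) \<Rightarrow> ('b \<Rightarrow> 'c) \<Rightarrow> bool" where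
  "exact L M N f g \<longleftrightarrow> f ` carrier L = Ker M N g \<and> k_normal M N g"

definition zero_monoid :: "unit ring" where
  "zero_monoid = \<lparr>carrier = {()}, mult = (\<lambda>_ _. ()), one = (), zero = (), add = (\<lambda>_ _. ())\<rparr>"

definition short_exact ::
  "('a, 'd) ring_scheme \<Rightarrow> ('b, 'e) ring_scheme \<Rightarrow> ('c, 'f) ring_scheme \<Rightarrow>
   ('a \<Rightarrow> 'b) \<Rightarrow> ('b \<Rightarrow> 'c) \<Rightarrow> bool" where
  "short_exact L M N f g \<longleftrightarrow>
     exact zero_monoid L M (\<lambda>_. \<zero>\<^bsub>L\<^esub>) f \<and>
     exact L M N f g \<and>
     exact M N zero_monoid g (\<lambda>_. ())"

section \<open>Monoids of homomorphisms\<close>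

text \<open>Linear maps are made \<^const>\<open>extensional\<close>, so that HOL equality of elements of
  \<open>Hom S L J\<close> is equality of maps on the carrier of \<open>L\<close>. Only the additive part of the record
  is meaningful.\<close>

definition Hom ::
  "('s, 'r) ring_scheme \<Rightarrow> ('s, 'l) module \<Rightarrow> ('s, 'j) module \<Rightarrow> ('l \<Rightarrow> 'j) ring" where
  "Hom S L J =
     \<lparr>carrier = {\<phi> \<in> extensional (carrier L). linear_map S L J \<phi>},
      mult = undefined, one = undefined,
      zero = (\<lambda>x\<in>carrier L. \<zero>\<^bsub>J\<^esub>),
      add = (\<lambda>\<phi> \<psi>. \<lambda>x\<in>carrier L. \<phi> x \<oplus>\<^bsub>J\<^esub> \<psi> x)\<rparr>"

definition precomp ::
  "('s, 'l) module \<Rightarrow> ('l \<Rightarrow> 'm) \<Rightarrow> ('m \<Rightarrow> 'j) \<Rightarrow> ('l \<Rightarrow> 'j)" where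
  "precomp L f = (\<lambda>\<phi>. compose (carrier L) \<phi> f)"

section \<open>Injectivity and retracts\<close>

text \<open>The outer terms of the sequences range over semimodules carried by the type of \<open>M\<close>. This
  loses nothing, since \<open>L\<close> embeds in \<open>M\<close> and \<open>N\<close> is a quotient of \<open>M\<close>: the theorem
  \<open>rel_e_injective_any_types\<close> below removes the restriction.\<close>

definition rel_e_injective ::
  "('s, 'r) ring_scheme \<Rightarrow> ('s, 'm) module \<Rightarrow> ('s, 'j) module \<Rightarrow> bool" where
  "rel_e_injective S M J \<longleftrightarrow>
     (\<forall>(L :: ('s, 'm) module) (N :: ('s, 'm) module) f g.
        left_semimodule S L \<and> left_semimodule S N \<and>
        linear_map S L M f \<and> linear_map S M N g \<and> short_exact L M N f g \<longrightarrow>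
        short_exact (Hom S N J) (Hom S M J) (Hom S L J) (precomp M g) (precomp L f))"

text \<open>HOL cannot quantify over types inside a formula, so the type carrying the test
  semimodules \<open>M\<close> is a parameter; it is independent of the type of \<open>J\<close>.\<close>

definition e_injective ::
  "'u itself \<Rightarrow> ('s, 'r) ring_scheme \<Rightarrow> ('s, 'j) module \<Rightarrow> bool" where
  "e_injective U S J \<longleftrightarrow>
     (\<forall>M :: ('s, 'u) module. left_semimodule S M \<longrightarrow> rel_e_injective S M J)"

definition semimodule_retract ::
  "('s, 'r) ring_scheme \<Rightarrow> ('s, 'i) module \<Rightarrow> ('s, 'j) module \<Rightarrow> bool" where
  "semimodule_retract S I J \<longleftrightarrow>
     (\<exists>\<psi> \<theta>. linear_map S I J \<psi> \<and> linear_map S J I \<theta> \<and> (\<forall>x\<in>carrier I. \<theta> (\<psi> x) = x))"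

section \<open>Independence of the types of the outer terms\<close>

lemma linear_map_zero:
  assumes "left_semimodule S L" "left_semimodule S M" "linear_map S L M f"
  shows "f \<zero>\<^bsub>L\<^esub> = \<zero>\<^bsub>M\<^esub>"
proof -
  interpret L: left_semimodule S L by fact
  interpret M: left_semimodule S M by fact
  have "f \<zero>\<^bsub>L\<^esub> = f (\<zero>\<^bsub>S\<^esub> \<odot>\<^bsub>L\<^esub> \<zero>\<^bsub>L\<^esub>)"
    by (simp add: L.smult_l_null)
  also have "\<dots> = \<zero>\<^bsub>S\<^esub> \<odot>\<^bsub>M\<^esub> f \<zero>\<^bsub>L\<^esub>"
    using assms(3) by (auto simp: linear_map_def)
  also have "\<dots> = \<zero>\<^bsub>M\<^esub>"
    using assms(3) by (intro M.smult_l_null) (auto simp: linear_map_def)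
  finally show ?thesis .
qed

lemma short_exact_iff:
  assumes "abelian_monoid L" "abelian_monoid N"
  shows "short_exact L M N f g \<longleftrightarrow>
     Ker L M f = {\<zero>\<^bsub>L\<^esub>} \<and> inj_on f (carrier L) \<and>
     f ` carrier L = Ker M N g \<and> k_normal M N g \<and> g ` carrier M = carrier N"
proof -
  interpret L: abelian_monoid L by fact
  interpret N: abelian_monoid N by fact
  have 1: "exact zero_monoid L M (\<lambda>_. \<zero>\<^bsub>L\<^esub>) f \<longleftrightarrow> Ker L M f = {\<zero>\<^bsub>L\<^esub>} \<and> inj_on f (carrier L)"
  proof -
    have "Ker L M f = {\<zero>\<^bsub>L\<^esub>} \<Longrightarrow> k_normal L M f \<longleftrightarrow> inj_on f (carrier L)"
      by (auto simp: k_normal_def inj_on_def)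
    moreover have "exact zero_monoid L M (\<lambda>_. \<zero>\<^bsub>L\<^esub>) f \<longleftrightarrow> Ker L M f = {\<zero>\<^bsub>L\<^esub>} \<and> k_normal L M f"
      by (auto simp: exact_def zero_monoid_def)
    ultimately show ?thesis by blast
  qed
  have K: "Ker N zero_monoid (\<lambda>_. ()) = carrier N"
    by (auto simp: Ker_def zero_monoid_def)
  have "\<exists>k\<in>carrier N. \<exists>k'\<in>carrier N. l \<oplus>\<^bsub>N\<^esub> k = l' \<oplus>\<^bsub>N\<^esub> k'"
    if "l \<in> carrier N" "l' \<in> carrier N" for l l'
    using that N.a_comm by blast
  then have "k_normal N zero_monoid (\<lambda>_. ())"
    by (simp add: k_normal_def K)
  then have 2: "exact M N zero_monoid g (\<lambda>_. ()) \<longleftrightarrow> g ` carrier M = carrier N"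
    by (simp add: exact_def K)
  show ?thesis
    unfolding short_exact_def 1 2 by (auto simp: exact_def)
qed

lemma Hom_abelian_monoid:
  assumes "left_semimodule S L" "left_semimodule S J"
  shows "abelian_monoid (Hom S L J)"
proof -
  interpret L: left_semimodule S L by fact
  interpret J: left_semimodule S J by fact
  show ?thesis
  proof (rule abelian_monoidI)
    fix \<phi> \<psi> assume "\<phi> \<in> carrier (Hom S L J)" "\<psi> \<in> carrier (Hom S L J)"
    then have h: "linear_map S L J \<phi>" "linear_map S L J \<psi>"
      by (auto simp: Hom_def)
    then have [simp]: "\<And>x. x \<in> carrier L \<Longrightarrow> \<phi> x \<in> carrier J" "\<And>x. x \<in> carrier L \<Longrightarrow> \<psi> x \<in> carrier J"
      by (auto simp: linear_map_def)
    show "\<phi> \<oplus>\<^bsub>Hom S L J\<^esub> \<psi> \<in> carrier (Hom S L J)"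
      using h by (auto simp: Hom_def linear_map_def L.smult_closed J.smult_r_distr J.a_ac)
    show "\<phi> \<oplus>\<^bsub>Hom S L J\<^esub> \<psi> = \<psi> \<oplus>\<^bsub>Hom S L J\<^esub> \<phi>"
      by (auto simp: Hom_def J.a_comm)
  next
    show "\<zero>\<^bsub>Hom S L J\<^esub> \<in> carrier (Hom S L J)"
      by (auto simp: Hom_def linear_map_def L.smult_closed J.smult_r_null)
  next
    fix \<phi> \<psi> \<chi>
    assume "\<phi> \<in> carrier (Hom S L J)" "\<psi> \<in> carrier (Hom S L J)" "\<chi> \<in> carrier (Hom S L J)"
    then have "\<And>x. x \<in> carrier L \<Longrightarrow> \<phi> x \<in> carrier J \<and> \<psi> x \<in> carrier J \<and> \<chi> x \<in> carrier J"
      by (auto simp: Hom_def linear_map_def)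
    then show "\<phi> \<oplus>\<^bsub>Hom S L J\<^esub> \<psi> \<oplus>\<^bsub>Hom S L J\<^esub> \<chi> = \<phi> \<oplus>\<^bsub>Hom S L J\<^esub> (\<psi> \<oplus>\<^bsub>Hom S L J\<^esub> \<chi>)"
      by (auto simp: Hom_def J.a_assoc)
  next
    fix \<phi> assume "\<phi> \<in> carrier (Hom S L J)"
    then have "\<phi> \<in> extensional (carrier L)" "\<And>x. x \<in> carrier L \<Longrightarrow> \<phi> x \<in> carrier J"
      by (auto simp: Hom_def linear_map_def)
    then show "\<zero>\<^bsub>Hom S L J\<^esub> \<oplus>\<^bsub>Hom S L J\<^esub> \<phi> = \<phi>"
      by (auto simp: Hom_def intro: extensionalityI)
  qed
qed

lemma precomp_Hom:
  assumes "left_semimodule S L" "linear_map S L M f" "\<phi> \<in> carrier (Hom S M J)"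
  shows "precomp L f \<phi> \<in> carrier (Hom S L J)"
proof -
  interpret L: left_semimodule S L by fact
  show ?thesis
    using assms(2,3)
    by (auto simp: Hom_def precomp_def compose_def linear_map_def L.smult_closed Pi_iff)
qed

lemma precomp_zero_iff:
  "precomp L f \<phi> = \<zero>\<^bsub>Hom S L J\<^esub> \<longleftrightarrow> (\<forall>x\<in>carrier L. \<phi> (f x) = \<zero>\<^bsub>J\<^esub>)"
  by (auto simp: precomp_def Hom_def compose_def fun_eq_iff restrict_def)

lemma precomp_eq_iff:
  "precomp L f \<phi> = precomp L f \<psi> \<longleftrightarrow> (\<forall>x\<in>carrier L. \<phi> (f x) = \<psi> (f x))"
  by (auto simp: precomp_def compose_def fun_eq_iff restrict_def)

theorem rel_e_injective_any_types:
  fixes S :: "('s, 'r) ring_scheme" and M :: "('s, 'm) module" and J :: "('s, 'j) module"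
    and L :: "('s, 'l) module" and N :: "('s, 'n) module"
  assumes M: "left_semimodule S M" and J: "left_semimodule S J"
    and L: "left_semimodule S L" and N: "left_semimodule S N"
    and f: "linear_map S L M f" and g: "linear_map S M N g"
    and se: "short_exact L M N f g"
    and inj: "rel_e_injective S M J"
  shows "short_exact (Hom S N J) (Hom S M J) (Hom S L J) (precomp M g) (precomp L f)"
proof -
  interpret M: left_semimodule S M by fact
  interpret J: left_semimodule S J by fact
  interpret L: left_semimodule S L by fact
  interpret N: left_semimodule S N by fact
  have amL: "abelian_monoid L" and amN: "abelian_monoid N" by unfold_locales
  have seD: "Ker L M f = {\<zero>\<^bsub>L\<^esub>}" "inj_on f (carrier L)"
    "f ` carrier L = Ker M N g" "k_normal M N g" "g ` carrier M = carrier N"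
    using se by (simp_all add: short_exact_iff[OF amL amN])
  have fL: "f x \<in> carrier M" if "x \<in> carrier L" for x
    using f that by (auto simp: linear_map_def)
  have gM: "g x \<in> carrier N" if "x \<in> carrier M" for x
    using g that by (auto simp: linear_map_def)
  have fadd: "f x \<oplus>\<^bsub>M\<^esub> f y = f (x \<oplus>\<^bsub>L\<^esub> y)" if "x \<in> carrier L" "y \<in> carrier L" for x y
    using f that by (auto simp: linear_map_def)
  have fsm: "a \<odot>\<^bsub>M\<^esub> f x = f (a \<odot>\<^bsub>L\<^esub> x)" if "a \<in> carrier S" "x \<in> carrier L" for a x
    using f that by (auto simp: linear_map_def)
  have gadd: "g (x \<oplus>\<^bsub>M\<^esub> y) = g x \<oplus>\<^bsub>N\<^esub> g y" if "x \<in> carrier M" "y \<in> carrier M" for x y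
    using g that by (auto simp: linear_map_def)
  have gsm: "g (a \<odot>\<^bsub>M\<^esub> x) = a \<odot>\<^bsub>N\<^esub> g x" if "a \<in> carrier S" "x \<in> carrier M" for a x
    using g that by (auto simp: linear_map_def)
  note f0 = linear_map_zero[OF L M f] and g0 = linear_map_zero[OF M N g]

  define L' where "L' = M\<lparr>carrier := f ` carrier L\<rparr>"
  define s where "s = inv_into (carrier M) g"
  have sM: "s y \<in> carrier M" and gs: "g (s y) = y" if "y \<in> carrier N" for y
    using that seD(5) by (auto simp: s_def inv_into_into f_inv_into_f)
  define N' :: "('s, 'm) module" where
    "N' = \<lparr>carrier = s ` carrier N, mult = undefined, one = undefined, zero = s \<zero>\<^bsub>N\<^esub>,
           add = (\<lambda>x y. s (g x \<oplus>\<^bsub>N\<^esub> g y)), smult = (\<lambda>a x. s (a \<odot>\<^bsub>N\<^esub> g x))\<rparr>"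
  have L'_simps [simp]: "carrier L' = f ` carrier L" "\<zero>\<^bsub>L'\<^esub> = \<zero>\<^bsub>M\<^esub>"
    "x \<oplus>\<^bsub>L'\<^esub> y = x \<oplus>\<^bsub>M\<^esub> y" "a \<odot>\<^bsub>L'\<^esub> x = a \<odot>\<^bsub>M\<^esub> x" for x y a
    by (simp_all add: L'_def)
  have N'_simps [simp]: "carrier N' = s ` carrier N" "\<zero>\<^bsub>N'\<^esub> = s \<zero>\<^bsub>N\<^esub>"
    "x \<oplus>\<^bsub>N'\<^esub> y = s (g x \<oplus>\<^bsub>N\<^esub> g y)" "a \<odot>\<^bsub>N'\<^esub> x = s (a \<odot>\<^bsub>N\<^esub> g x)" for x y a
    by (simp_all add: N'_def)
  have amL': "abelian_monoid L'"
  proof (rule abelian_monoidI)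
    show "\<zero>\<^bsub>L'\<^esub> \<in> carrier L'" using f0 by (auto intro!: rev_image_eqI[of "\<zero>\<^bsub>L\<^esub>"])
  qed (auto simp: fadd fL L.a_ac)
  have L': "left_semimodule S L'"
  proof (intro left_semimodule.intro left_semimodule_axioms.intro)
    show "nonzero_semiring S" by unfold_locales
  qed (auto simp: amL' fsm fadd f0 L.smult_closed L.smult_l_distr L.smult_r_distr
          L.smult_assoc L.smult_one L.smult_l_null M.smult_r_null)
  have amN': "abelian_monoid N'"
    by (rule abelian_monoidI) (auto simp: gs N.a_ac)
  have N': "left_semimodule S N'"
  proof (intro left_semimodule.intro left_semimodule_axioms.intro)
    show "nonzero_semiring S" by unfold_locales
  qed (auto simp: amN' gs N.smult_closed N.smult_l_distr N.smult_r_distr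
          N.smult_assoc N.smult_one N.smult_l_null N.smult_r_null)

  have f': "linear_map S L' M (\<lambda>x. x)"
    by (auto simp: linear_map_def fL)
  have g': "linear_map S M N' (\<lambda>x. s (g x))"
    by (auto simp: linear_map_def gM gadd gsm gs)
  have sinj: "s x = s y \<longleftrightarrow> x = y" if "x \<in> carrier N" "y \<in> carrier N" for x y
    using gs that by metis
  have KerN': "Ker M N' (\<lambda>x. s (g x)) = Ker M N g"
    by (auto simp: Ker_def sinj gM)
  have "short_exact L' M N' (\<lambda>x. x) (\<lambda>x. s (g x))"
    unfolding short_exact_iff[OF amL' amN']
  proof (intro conjI)
    show "Ker L' M (\<lambda>x. x) = {\<zero>\<^bsub>L'\<^esub>}"
      using abelian_monoid.zero_closed[OF amL'] by (auto simp: Ker_def)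
    show "k_normal M N' (\<lambda>x. s (g x))"
      using seD(4) by (auto simp: k_normal_def KerN' sinj gM)
    show "(\<lambda>x. s (g x)) ` carrier M = carrier N'"
      by (simp add: seD(5)[symmetric] image_image)
  qed (auto simp: KerN' seD(3)[symmetric])
  then have "short_exact (Hom S N' J) (Hom S M J) (Hom S L' J)
      (precomp M (\<lambda>x. s (g x))) (precomp L' (\<lambda>x. x))"
    using inj L' N' f' g' by (auto simp: rel_e_injective_def)
  then have H: "precomp M (\<lambda>x. s (g x)) ` carrier (Hom S N' J)
        = Ker (Hom S M J) (Hom S L' J) (precomp L' (\<lambda>x. x))"
      "k_normal (Hom S M J) (Hom S L' J) (precomp L' (\<lambda>x. x))"
      "precomp L' (\<lambda>x. x) ` carrier (Hom S M J) = carrier (Hom S L' J)"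
    by (simp_all add: short_exact_iff[OF Hom_abelian_monoid[OF N' J] Hom_abelian_monoid[OF L' J]])
  have K: "Ker (Hom S M J) (Hom S L' J) (precomp L' (\<lambda>x. x))
         = Ker (Hom S M J) (Hom S L J) (precomp L f)"
    by (auto simp: Ker_def precomp_zero_iff)

  show ?thesis
    unfolding short_exact_iff[OF Hom_abelian_monoid[OF N J] Hom_abelian_monoid[OF L J]]
  proof (intro conjI)
    show inj': "inj_on (precomp M g) (carrier (Hom S N J))"
    proof (rule inj_onI)
      fix \<phi> \<psi>
      assume a: "\<phi> \<in> carrier (Hom S N J)" "\<psi> \<in> carrier (Hom S N J)"
        and e: "precomp M g \<phi> = precomp M g \<psi>"
      have "\<phi> y = \<psi> y" if "y \<in> carrier N" for y
        using e sM[OF that] gs[OF that] unfolding precomp_eq_iff by metis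
      then show "\<phi> = \<psi>"
        using a by (auto simp: Hom_def intro: extensionalityI)
    qed
    have z: "\<zero>\<^bsub>Hom S N J\<^esub> \<in> carrier (Hom S N J)"
      using abelian_monoid.zero_closed[OF Hom_abelian_monoid[OF N J]] .
    have z0: "precomp M g \<zero>\<^bsub>Hom S N J\<^esub> = \<zero>\<^bsub>Hom S M J\<^esub>"
      unfolding precomp_zero_iff by (auto simp: Hom_def gM)
    show "Ker (Hom S N J) (Hom S M J) (precomp M g) = {\<zero>\<^bsub>Hom S N J\<^esub>}"
      using inj' z z0 by (auto simp: Ker_def inj_on_def)
    show "precomp M g ` carrier (Hom S N J) = Ker (Hom S M J) (Hom S L J) (precomp L f)"
      unfolding K[symmetric] H(1)[symmetric]
    proof (intro equalityI image_subsetI)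
      fix \<phi> assume a: "\<phi> \<in> carrier (Hom S N J)"
      have "linear_map S N' N g"
        by (auto simp: linear_map_def gs N.smult_closed)
      then have "precomp N' g \<phi> \<in> carrier (Hom S N' J)"
        using precomp_Hom[OF N'] a by blast
      moreover have "precomp M g \<phi> = precomp M (\<lambda>x. s (g x)) (precomp N' g \<phi>)"
        by (auto simp: precomp_def compose_def fun_eq_iff restrict_def gM gs)
      ultimately show "precomp M g \<phi> \<in> precomp M (\<lambda>x. s (g x)) ` carrier (Hom S N' J)"
        by blast
    next
      fix \<phi> assume a: "\<phi> \<in> carrier (Hom S N' J)"
      have "linear_map S N N' s"
        by (auto simp: linear_map_def gs)
      then have "precomp N s \<phi> \<in> carrier (Hom S N J)"
        using precomp_Hom[OF N] a by blast
      moreover have "precomp M (\<lambda>x. s (g x)) \<phi> = precomp M g (precomp N s \<phi>)"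
        by (auto simp: precomp_def compose_def fun_eq_iff restrict_def gM)
      ultimately show "precomp M (\<lambda>x. s (g x)) \<phi> \<in> precomp M g ` carrier (Hom S N J)"
        by blast
    qed
    show "k_normal (Hom S M J) (Hom S L J) (precomp L f)"
      using H(2) by (simp add: k_normal_def K precomp_eq_iff)
    show "precomp L f ` carrier (Hom S M J) = carrier (Hom S L J)"
    proof (intro equalityI image_subsetI subsetI)
      fix \<phi> assume "\<phi> \<in> carrier (Hom S M J)"
      then show "precomp L f \<phi> \<in> carrier (Hom S L J)"
        by (rule precomp_Hom[OF L f])
    next
      fix h assume h: "h \<in> carrier (Hom S L J)"
      define r where "r = inv_into (carrier L) f"
      have rf: "r (f x) = x" if "x \<in> carrier L" for x
        using seD(2) that by (simp add: r_def)
      have "linear_map S L' L r"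
        by (auto simp: linear_map_def rf fadd fsm L.smult_closed)
      then have "precomp L' r h \<in> carrier (Hom S L' J)"
        using precomp_Hom[OF L'] h by blast
      then obtain \<phi> where \<phi>: "\<phi> \<in> carrier (Hom S M J)"
        and e: "precomp L' r h = precomp L' (\<lambda>x. x) \<phi>"
        unfolding H(3)[symmetric] by blast
      have "h x = \<phi> (f x)" if "x \<in> carrier L" for x
        using fun_cong[OF e, of "f x"] that by (auto simp: precomp_def compose_def rf)
      then have "h = precomp L f \<phi>"
        using h by (auto simp: Hom_def precomp_def compose_def extensional_def fun_eq_iff)
      then show "h \<in> precomp L f ` carrier (Hom S M J)"
        using \<phi> by blast
    qed
  qed
qed

end

theory Submission
  imports Defs
begin

text \<open>Postcomposition with the two retract maps exhibits the sequence of homomorphism monoids into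
  \<open>I\<close> as a retract of the one into \<open>J\<close>, and a retract of an exact sequence of monoids
  is exact.\<close>

lemma exact_retract:
  assumes ex: "exact A B C f g"
    and rA: "rA ` carrier A = carrier A'"
    and rB: "rB \<in> carrier B \<rightarrow> carrier B'"
      "\<And>x y. x \<in> carrier B \<Longrightarrow> y \<in> carrier B \<Longrightarrow> rB (x \<oplus>\<^bsub>B\<^esub> y) = rB x \<oplus>\<^bsub>B'\<^esub> rB y"
    and iB: "iB \<in> carrier B' \<rightarrow> carrier B" "\<And>x. x \<in> carrier B' \<Longrightarrow> rB (iB x) = x"
    and rC: "rC \<zero>\<^bsub>C\<^esub> = \<zero>\<^bsub>C'\<^esub>" and iC: "iC \<zero>\<^bsub>C'\<^esub> = \<zero>\<^bsub>C\<^esub>"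
    and rf: "\<And>x. x \<in> carrier A \<Longrightarrow> f' (rA x) = rB (f x)"
    and rg: "\<And>x. x \<in> carrier B \<Longrightarrow> g' (rB x) = rC (g x)"
    and ig: "\<And>x. x \<in> carrier B' \<Longrightarrow> g (iB x) = iC (g' x)"
  shows "exact A' B' C' f' g'"
proof -
  have im: "f ` carrier A = Ker B C g" and kn: "k_normal B C g"
    using ex by (auto simp: exact_def)
  have rK: "rB k \<in> Ker B' C' g'" if "k \<in> Ker B C g" for k
    using that rB(1) rg rC by (auto simp: Ker_def)
  have iK: "iB k \<in> Ker B C g" if "k \<in> Ker B' C' g'" for k
    using that iB(1) ig iC by (auto simp: Ker_def)
  have "f' ` carrier A' = rB ` Ker B C g"
    unfolding im[symmetric] rA[symmetric] image_image using rf by (rule image_cong[OF refl])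
  \<comment> \<open>For surjectivity onto the kernel, \<open>iB\<close> supplies the
    preimage.\<close>
  also have "\<dots> = Ker B' C' g'"
  proof (intro equalityI image_subsetI subsetI)
    fix x assume x: "x \<in> Ker B' C' g'"
    then have "x = rB (iB x)" using iB(2) by (simp add: Ker_def)
    then show "x \<in> rB ` Ker B C g" using iK[OF x] by (rule image_eqI)
  qed (rule rK)
  finally have "f' ` carrier A' = Ker B' C' g'" .
  moreover have "k_normal B' C' g'"
    unfolding k_normal_def
  proof (intro ballI impI)
    fix x y assume x: "x \<in> carrier B'" and y: "y \<in> carrier B'" and "g' x = g' y"
    \<comment> \<open>The pair is moved into \<open>B\<close>, where \<open>g\<close> is k-normal.
      The equation found there is then pushed back along \<open>rB\<close>, whose additivity splits
      the sums and which undoes \<open>iB\<close>.\<close>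
    then have "g (iB x) = g (iB y)" by (simp add: ig)
    then obtain k k' where k: "k \<in> Ker B C g" "k' \<in> Ker B C g"
      and e: "iB x \<oplus>\<^bsub>B\<^esub> k = iB y \<oplus>\<^bsub>B\<^esub> k'"
      using kn x y iB(1) unfolding k_normal_def by blast
    have "k \<in> carrier B" "k' \<in> carrier B" using k by (auto simp: Ker_def)
    then have "x \<oplus>\<^bsub>B'\<^esub> rB k = y \<oplus>\<^bsub>B'\<^esub> rB k'"
      using arg_cong[OF e, of rB] x y iB by (auto simp: rB(2) Pi_iff)
    then show "\<exists>k\<in>Ker B' C' g'. \<exists>k'\<in>Ker B' C' g'. x \<oplus>\<^bsub>B'\<^esub> k = y \<oplus>\<^bsub>B'\<^esub> k'"
      using rK k by blast
  qed
  ultimately show ?thesis by (simp add: exact_def)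
qed

text \<open>Linearity passes through composition. Using \<open>compose\<close> instead of plain
  composition keeps the result extensional, as \<open>Hom\<close> demands.\<close>

lemma compose_Hom:
  assumes "left_semimodule S L" "linear_map S J I \<theta>" "\<phi> \<in> carrier (Hom S L J)"
  shows "compose (carrier L) \<theta> \<phi> \<in> carrier (Hom S L I)"
proof -
  interpret L: left_semimodule S L by fact
  show ?thesis
    using assms(2,3) by (auto simp: Hom_def compose_def linear_map_def L.smult_closed Pi_iff)
qed

lemma compose_Hom_add:
  assumes "linear_map S J I \<theta>"
    "\<phi> \<in> carrier (Hom S L J)" "\<chi> \<in> carrier (Hom S L J)"
  shows "compose (carrier L) \<theta> (\<phi> \<oplus>\<^bsub>Hom S L J\<^esub> \<chi>) =
    compose (carrier L) \<theta> \<phi> \<oplus>\<^bsub>Hom S L I\<^esub> compose (carrier L) \<theta> \<chi>"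
  using assms by (auto simp: Hom_def compose_def linear_map_def Pi_iff)

lemma compose_Hom_zero:
  assumes "left_semimodule S J" "left_semimodule S I" "linear_map S J I \<theta>"
  shows "compose (carrier L) \<theta> \<zero>\<^bsub>Hom S L J\<^esub> = \<zero>\<^bsub>Hom S L I\<^esub>"
  using linear_map_zero[OF assms] by (auto simp: Hom_def compose_def)

text \<open>Associativity of composition: on \<open>carrier L\<close> both sides are
  \<open>\<theta> (\<phi> (f x))\<close>, since \<open>f\<close> lands in \<open>carrier M\<close>,
  where the restriction has no effect. This gives the commuting squares for
  \<open>exact_retract\<close>.\<close>

lemma precomp_compose:
  assumes "linear_map S L M f"
  shows "precomp L f (compose (carrier M) \<theta> \<phi>) = compose (carrier L) \<theta> (precomp L f \<phi>)"
  using assms by (auto simp: precomp_def compose_def linear_map_def Pi_iff intro!: restrict_ext)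

text \<open>On \<open>carrier L\<close> the values of \<open>\<phi>\<close> lie in \<open>I\<close>,
  where \<open>\<theta>\<close> undoes \<open>\<psi>\<close>; elsewhere both sides are
  \<open>undefined\<close> by extensionality.\<close>

lemma compose_Hom_retract:
  assumes "\<And>x. x \<in> carrier I \<Longrightarrow> \<theta> (\<psi> x) = x" "\<phi> \<in> carrier (Hom S L I)"
  shows "compose (carrier L) \<theta> (compose (carrier L) \<psi> \<phi>) = \<phi>"
  using assms by (auto simp: Hom_def compose_def linear_map_def Pi_iff intro: extensionalityI)

text \<open>Each of the three exactness conditions follows from \<open>exact_retract\<close>, with
  postcomposition by \<open>\<theta>\<close> as retraction and by \<open>\<psi>\<close> as
  section.\<close>

lemma short_exact_Hom_retract:
  fixes L M N :: "('s, 'm) module"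
  assumes L: "left_semimodule S L" and M: "left_semimodule S M" and N: "left_semimodule S N"
    and J: "left_semimodule S J" and I: "left_semimodule S I"
    and f: "linear_map S L M f" and g: "linear_map S M N g"
    and se: "short_exact (Hom S N J) (Hom S M J) (Hom S L J) (precomp M g) (precomp L f)"
    and retr: "semimodule_retract S I J"
  shows "short_exact (Hom S N I) (Hom S M I) (Hom S L I) (precomp M g) (precomp L f)"
proof -
  obtain \<psi> \<theta> where \<psi>: "linear_map S I J \<psi>" and \<theta>: "linear_map S J I \<theta>"
    and id: "\<And>x. x \<in> carrier I \<Longrightarrow> \<theta> (\<psi> x) = x"
    using retr unfolding semimodule_retract_def by blast
  note zero = compose_Hom_zero[OF J I \<theta>] compose_Hom_zero[OF I J \<psi>]
  \<comment> \<open>The preimage of \<open>\<phi>\<close> is \<open>\<psi>\<close> after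
    \<open>\<phi>\<close>. This provides the surjectivity that \<open>exact_retract\<close> asks of
    \<open>rA\<close>.\<close>
  have surj: "compose (carrier X) \<theta> ` carrier (Hom S X J) = carrier (Hom S X I)"
    if "left_semimodule S X" for X :: "('s, 'm) module"
  proof (intro equalityI image_subsetI subsetI)
    fix \<phi> assume \<phi>: "\<phi> \<in> carrier (Hom S X I)"
    show "\<phi> \<in> compose (carrier X) \<theta> ` carrier (Hom S X J)"
      using compose_Hom_retract[where \<theta> = \<theta> and \<psi> = \<psi>, OF id \<phi>, symmetric]
        compose_Hom[OF that \<psi> \<phi>]
      by (rule image_eqI)
  qed (rule compose_Hom[OF that \<theta>])
  note maps = compose_Hom[OF _ \<theta>] compose_Hom[OF _ \<psi>] compose_Hom_add[OF \<theta>]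
    compose_Hom_retract[where \<theta> = \<theta> and \<psi> = \<psi>, OF id] zero
    precomp_compose[OF f] precomp_compose[OF g]
  show ?thesis
    unfolding short_exact_def
  proof (intro conjI)
    show "exact zero_monoid (Hom S N I) (Hom S M I) (\<lambda>_. \<zero>\<^bsub>Hom S N I\<^esub>) (precomp M g)"
      \<comment> \<open>The left term is the one-point monoid for both \<open>J\<close> and
        \<open>I\<close>, so its comparison map is the identity, and the square beside it says that
        postcomposition by \<open>\<theta>\<close> preserves zero.\<close>
      by (rule exact_retract[where rA = "\<lambda>x. x" and rB = "compose (carrier N) \<theta>"
            and iB = "compose (carrier N) \<psi>" and rC = "compose (carrier M) \<theta>"
            and iC = "compose (carrier M) \<psi>", OF se[unfolded short_exact_def, THEN conjunct1]])
        (auto simp: maps N)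
    show "exact (Hom S N I) (Hom S M I) (Hom S L I) (precomp M g) (precomp L f)"
      by (rule exact_retract[where rA = "compose (carrier N) \<theta>"
            and rB = "compose (carrier M) \<theta>" and iB = "compose (carrier M) \<psi>"
            and rC = "compose (carrier L) \<theta>" and iC = "compose (carrier L) \<psi>",
            OF se[unfolded short_exact_def, THEN conjunct2, THEN conjunct1]])
        (auto simp: maps M surj[OF N])
    show "exact (Hom S M I) (Hom S L I) zero_monoid (precomp L f) (\<lambda>_. ())"
      by (rule exact_retract[where rA = "compose (carrier M) \<theta>"
            and rB = "compose (carrier L) \<theta>" and iB = "compose (carrier L) \<psi>"
            and rC = "\<lambda>x. x" and iC = "\<lambda>x. x",
            OF se[unfolded short_exact_def, THEN conjunct2, THEN conjunct2]])
        (auto simp: maps L surj[OF M])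
  qed
qed

text \<open>The test sequences depend on \<open>M\<close> alone, so each one for \<open>I\<close> is
  also one for \<open>J\<close>, and exactness of its \<open>Hom\<close> sequence transfers.\<close>

lemma rel_e_injective_retract:
  assumes "left_semimodule S M" "left_semimodule S J" "left_semimodule S I"
    and "rel_e_injective S M J" "semimodule_retract S I J"
  shows "rel_e_injective S M I"
  using assms short_exact_Hom_retract unfolding rel_e_injective_def by blast

theorem proposition2p12:
  fixes S :: "('s, 'r) ring_scheme"
  assumes "nonzero_semiring S"
  shows "(\<forall>(M :: ('s, 'm) module) (J :: ('s, 'j) module) (I :: ('s, 'i) module).
            left_semimodule S M \<and> left_semimodule S J \<and> left_semimodule S I \<and>
            rel_e_injective S M J \<and> semimodule_retract S I J
            \<longrightarrow> rel_e_injective S M I) \<and>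
         (\<forall>(J :: ('s, 'j) module) (I :: ('s, 'i) module).
            left_semimodule S J \<and> left_semimodule S I \<and>
            e_injective TYPE('u) S J \<and> semimodule_retract S I J
            \<longrightarrow> e_injective TYPE('u) S I)"
  \<comment> \<open>Fixing the test semimodule \<open>M\<close> reduces the second claim to the
    relative one.\<close>
  unfolding e_injective_def
  by (intro conjI allI impI; elim conjE; rule rel_e_injective_retract; blast)

end
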